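(* Let $U$ be a generalized Jordan triple system of second order over a field $\Phi$ of characteristic different from $2,3,5$, and let $e\in U$ be a tripotent ($(eee)=e$) that is a left unit, i.e. $(eex)=x$ for all $x\in U$. Let $R(x)=(xee)$, $Q(x)=(exe)$ and $x\circ y=(xey)$. Then $U$ is a direct sum $$U=U_{11}^{+}\oplus U_{11}^{-}\oplus U_{13}^{+}\oplus U_{13}^{-},$$ the operator $Q$ is invertible, and the triple product has the form $$(xyz)=(Q^{-1}(y)\circ x)\circ z+x\circ(Q^{-1}(y)\circ z)-Q^{-1}(y)\circ(x\circ z).$$ The bilinear operation $\circ$ has the form $x\circ y=A_1(x,y)+A_3(x,y)$ with $A_1(x,y)\in U_{11}$, $A_3(x,y)\in U_{13}$, where $$A_1(x,y)=A_1(y,x)\quad\forall x,y\in U,$$ $$A_3(x,y)=\begin{cases}-A_3(y,x)&\forall x,y\in U_{11},\\-A_3(y,x)&\forall x,y\in U_{13},\\ 3A_3(y,x)&\forall x\in U_{13},\ y\in U_{11}.\end{cases}$$ Moreover, the linear transformation $x\mapsto\tilde x$ defined by $$\tilde x=x\ \ \forall x\in U_{+}=U_{11}^{+}\oplus U_{13}^{-},\qquad \tilde x=-x\ \ \forall x\in U_{-}=U_{11}^{-}\oplus U_{13}^{+}$$ is an involutive automorphism of the algebra $(U,\circ)$. Hence $$U_{+}\circ U_{+}\subset U_{+},\quad U_{-}\circ U_{-}\subset U_{+},\quad U_{-}\circ U_{+}\subset U_{-},\quad U_{+}\circ U_{-}\subset U_{-}.$$ If in addition the triple system is weakly commutative,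 then $U_{13}^{+}=0$, so that $U=U_{11}^{+}\oplus U_{11}^{-}\oplus U_{13}^{-}$, while $\circ$ has the same properties as in the general case.
   Context: A generalized Jordan triple system of second order is a vector space $U$ over $\Phi$ with a trilinear product $(xyz)$ satisfying, for all elements, $$(ab(cdf))=((abc)df)-(c(bad)f)+(cd(abf)),$$ $$[((avb)uc)-(cu(avb))-(cv(aub))-(a(vcu)b)]_{a,b}=0,$$ where $[F(a,b)]_{a,b}=F(a,b)-F(b,a)$. It is weakly commutative if $(yx(yyy))=((yyy)xy)$ for all $x,y\in U$. Here $U_{11}^{\pm}=\{x: R(x)=x,\ Q(x)=\pm x\}$, $U_{13}^{\pm}=\{x:R(x)=3x,\ Q(x)=\pm3x\}$, $U_{11}=U_{11}^{+}\oplus U_{11}^{-}$, $U_{13}=U_{13}^{+}\oplus U_{13}^{-}$; thus $Q$ acts as $\pm1$ on $U_{11}^{\pm}$ and as $\pm3$ on $U_{13}^{\pm}$. *)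

theory Defs
  imports Complex_Main
begin

locale gjts_second_order = vector_space scale
  for scale :: "'f::field \<Rightarrow> 'v::ab_group_add \<Rightarrow> 'v" +
  fixes T :: "'v \<Rightarrow> 'v \<Rightarrow> 'v \<Rightarrow> 'v"
  assumes linear_fst: "Vector_Spaces.linear scale scale (\<lambda>x. T x y z)"
    and linear_snd: "Vector_Spaces.linear scale scale (\<lambda>y. T x y z)"
    and linear_trd: "Vector_Spaces.linear scale scale (\<lambda>z. T x y z)"
    and jordan_identity:
      "T a b (T c d f) = T (T a b c) d f - T c (T b a d) f + T c d (T a b f)"
    and second_order_identity:
      "(T (T a v b) u c - T c u (T a v b) - T c v (T a u b) - T a (T v c u) b)
       - (T (T b v a) u c - T c u (T b v a) - T c v (T b u a) - T b (T v c u) a) = 0"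

definition weakly_commutative :: "('v \<Rightarrow> 'v \<Rightarrow> 'v \<Rightarrow> 'v) \<Rightarrow> bool" where
  "weakly_commutative T \<longleftrightarrow> (\<forall>x y. T y x (T y y y) = T (T y y y) x y)"

definition tripotent :: "('v \<Rightarrow> 'v \<Rightarrow> 'v \<Rightarrow> 'v) \<Rightarrow> 'v \<Rightarrow> bool" where
  "tripotent T e \<longleftrightarrow> T e e e = e"

definition left_unit :: "('v \<Rightarrow> 'v \<Rightarrow> 'v \<Rightarrow> 'v) \<Rightarrow> 'v \<Rightarrow> bool" where
  "left_unit T e \<longleftrightarrow> (\<forall>x. T e e x = x)"

definition R_op :: "('v \<Rightarrow> 'v \<Rightarrow> 'v \<Rightarrow> 'v) \<Rightarrow> 'v \<Rightarrow> 'v \<Rightarrow> 'v" where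
  "R_op T e x = T x e e"

definition Q_op :: "('v \<Rightarrow> 'v \<Rightarrow> 'v \<Rightarrow> 'v) \<Rightarrow> 'v \<Rightarrow> 'v \<Rightarrow> 'v" where
  "Q_op T e x = T e x e"

definition circ :: "('v \<Rightarrow> 'v \<Rightarrow> 'v \<Rightarrow> 'v) \<Rightarrow> 'v \<Rightarrow> 'v \<Rightarrow> 'v \<Rightarrow> 'v" where
  "circ T e x y = T x e y"

(* (W = V_1 \<oplus> ... \<oplus> V_n): each V_i is a subspace, and every element of W is
   uniquely v_1 + ... + v_n with v_i in V_i. *)
definition is_direct_sum ::
    "('f::field \<Rightarrow> 'v::ab_group_add \<Rightarrow> 'v) \<Rightarrow> 'v set \<Rightarrow> 'v set list \<Rightarrow> bool" where
  "is_direct_sum scale W Vs \<longleftrightarrow>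
     (\<forall>V\<in>set Vs. module.subspace scale V) \<and> bij_betw sum_list (listset Vs) W"

definition set_sum :: "'v::plus set \<Rightarrow> 'v set \<Rightarrow> 'v set" where
  "set_sum A B = {a + b | a b. a \<in> A \<and> b \<in> B}"

context
  fixes scale :: "'f::field \<Rightarrow> 'v::ab_group_add \<Rightarrow> 'v"
    and T :: "'v \<Rightarrow> 'v \<Rightarrow> 'v \<Rightarrow> 'v"
    and e :: 'v
begin

(* For the eigenvalues 1 and -1, no scalar action is needed. *)
definition U11p :: "'v set" where
  "U11p = {x. R_op T e x = x \<and> Q_op T e x = x}"

definition U11m :: "'v set" where
  "U11m = {x. R_op T e x = x \<and> Q_op T e x = - x}"

definition U13p :: "'v set" where
  "U13p = {x. R_op T e x = scale 3 x \<and> Q_op T e x = scale 3 x}"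

definition U13m :: "'v set" where
  "U13m = {x. R_op T e x = scale 3 x \<and> Q_op T e x = - scale 3 x}"

definition U11 :: "'v set" where "U11 = set_sum U11p U11m"

definition U13 :: "'v set" where "U13 = set_sum U13p U13m"

definition U_plus :: "'v set" where "U_plus = set_sum U11p U13m"

definition U_minus :: "'v set" where "U_minus = set_sum U11m U13p"

definition is_tilde :: "('v \<Rightarrow> 'v) \<Rightarrow> bool" where
  "is_tilde \<tau> \<longleftrightarrow> Vector_Spaces.linear scale scale \<tau> \<and>
     (\<forall>x\<in>U_plus. \<tau> x = x) \<and> (\<forall>x\<in>U_minus. \<tau> x = - x)"

end

definition involutive_automorphism ::
    "('f::field \<Rightarrow> 'v::ab_group_add \<Rightarrow> 'v) \<Rightarrow> ('v \<Rightarrow> 'v \<Rightarrow> 'v) \<Rightarrow> ('v \<Rightarrow> 'v) \<Rightarrow> bool" where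
  "involutive_automorphism scale m \<tau> \<longleftrightarrow>
     Vector_Spaces.linear scale scale \<tau> \<and> bij \<tau> \<and>
     (\<forall>x y. \<tau> (m x y) = m (\<tau> x) (\<tau> y)) \<and> (\<forall>x. \<tau> (\<tau> x) = x)"

end

theory Submission
  imports Defs
begin

text \<open>Write \<open>L(a,b) x = (abx)\<close>. Taking the second pair in the first identity to be \<open>(e,e)\<close>
  gives \<open>L((abe),e) = L(e,(bae))\<close>; hence \<open>R Q = Q R\<close> and \<open>R\<^sup>2 = Q\<^sup>2\<close>, while the second identity
  gives \<open>(R - 1)(R - 3) = 0\<close> and, more generally, that commutators of \<open>\<circ>\<close> lie in \<open>U13\<close>. These
  facts yield the decomposition. The triple product formula is the first identity for the pair
  \<open>(w,e)\<close> with \<open>y = Q w\<close>, and the second identity with all but two arguments equal to \<open>e\<close> computes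
  \<open>R (y \<circ> x)\<close> on eigenvectors of \<open>R\<close>, which is the rule for \<open>A3\<close>. Applying
  \<open>L((abe),e) = L(e,(bae))\<close> to \<open>e\<close> with \<open>a = Q w\<close>, \<open>b = Q x\<close> relates \<open>R\<close> and \<open>Q\<close> on products;
  evaluated on eigenvectors of \<open>R\<close>, it says that the tilde map is multiplicative. Finally, the part
  of the weak commutativity identity linear in \<open>y\<close> at \<open>e + y\<close> reads \<open>(R - 1)(R + Q) y = 0\<close>, which
  forces \<open>y = 0\<close> on \<open>U13+\<close>.\<close>

section \<open>Vector space preliminaries\<close>

text \<open>Numeral multiples become repeated sums, so that later identities can be checked in the
  additive group by \<open>algebra_simps\<close>.\<close>

lemma (in vector_space) scale_numerals:
  "scale 2 x = x + x" "scale 3 x = x + x + x" "scale 5 x = x + x + x + x + x"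
proof -
  have eqs: "(2::'a) = 1 + 1" "(3::'a) = 1 + 1 + 1" "(5::'a) = 1 + 1 + 1 + 1 + 1" by simp_all
  show "scale 2 x = x + x" "scale 3 x = x + x + x" "scale 5 x = x + x + x + x + x"
    by (simp_all only: eqs scale_left_distrib scale_one)
qed

text \<open>Two decompositions of one vector differ by an element of
  \<open>A \<inter> B\<close>.\<close>

lemma (in vector_space) is_direct_sum_set_sum:
  assumes "subspace A" "subspace B" and trivial: "A \<inter> B = {0}"
  shows "is_direct_sum scale (set_sum A B) [A, B]"
proof -
  have "inj_on sum_list (listset [A, B])"
  proof (rule inj_onI)
    fix us vs assume "us \<in> listset [A, B]" "vs \<in> listset [A, B]" and eq: "sum_list us = sum_list vs"
    then obtain a b c d where u: "us = [a, b]" "a \<in> A" "b \<in> B" and v: "vs = [c, d]" "c \<in> A" "d \<in> B"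
      by (auto simp: set_Cons_def)
    have "a - c = d - b" using eq u v by (simp add: algebra_simps)
    moreover have "a - c \<in> A" "d - b \<in> B" using u v assms subspace_diff by blast+
    ultimately have "a - c \<in> A \<inter> B" by simp
    then have "a - c = 0" using trivial by blast
    with \<open>a - c = d - b\<close> have "a - c = 0" "d - b = 0" by simp_all
    then show "us = vs" using u v by simp
  qed
  moreover have "sum_list ` listset [A, B] = set_sum A B"
    by (force simp: set_sum_def set_Cons_def image_iff)
  ultimately show ?thesis using assms by (simp add: is_direct_sum_def bij_betw_def)
qed

section \<open>Systems with a left unit: linearity and cancellation\<close>

locale gjts_left_unit = gjts_second_order scale T
  for scale :: "'f::field \<Rightarrow> 'v::ab_group_add \<Rightarrow> 'v" and T +
  fixes e :: 'v
  assumes left_unit: "T e e x = x"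
    and two_nz: "(2::'f) \<noteq> 0" and three_nz: "(3::'f) \<noteq> 0"
begin

abbreviation "R \<equiv> R_op T e"
abbreviation "Q \<equiv> Q_op T e"
abbreviation circ_op (infixl "\<circ>\<^sub>e" 70) where "x \<circ>\<^sub>e y \<equiv> circ T e x y"

lemmas T_add [simp] =
  Vector_Spaces.linear.axioms(3)[OF linear_fst, THEN module_hom.add]
  Vector_Spaces.linear.axioms(3)[OF linear_snd, THEN module_hom.add]
  Vector_Spaces.linear.axioms(3)[OF linear_trd, THEN module_hom.add]

lemmas T_diff [simp] =
  Vector_Spaces.linear.axioms(3)[OF linear_fst, THEN module_hom.diff]
  Vector_Spaces.linear.axioms(3)[OF linear_snd, THEN module_hom.diff]
  Vector_Spaces.linear.axioms(3)[OF linear_trd, THEN module_hom.diff]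

lemmas T_neg [simp] =
  Vector_Spaces.linear.axioms(3)[OF linear_fst, THEN module_hom.neg]
  Vector_Spaces.linear.axioms(3)[OF linear_snd, THEN module_hom.neg]
  Vector_Spaces.linear.axioms(3)[OF linear_trd, THEN module_hom.neg]

lemmas T_scale [simp] =
  Vector_Spaces.linear.axioms(3)[OF linear_fst, THEN module_hom.scale]
  Vector_Spaces.linear.axioms(3)[OF linear_snd, THEN module_hom.scale]
  Vector_Spaces.linear.axioms(3)[OF linear_trd, THEN module_hom.scale]

lemmas T_zero [simp] =
  Vector_Spaces.linear.axioms(3)[OF linear_fst, THEN module_hom.zero]
  Vector_Spaces.linear.axioms(3)[OF linear_snd, THEN module_hom.zero]

lemma linear_Q: "Vector_Spaces.linear scale scale Q"
  unfolding Q_op_def [abs_def] by (rule linear_snd)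

lemma RQ_simps [simp]:
  "R (x + y) = R x + R y" "R (x - y) = R x - R y" "R (- x) = - R x" "R (scale k x) = scale k (R x)" "R 0 = 0"
  "Q (x + y) = Q x + Q y" "Q (x - y) = Q x - Q y" "Q (- x) = - Q x" "Q (scale k x) = scale k (Q x)" "Q 0 = 0"
  by (simp_all add: R_op_def Q_op_def)

lemma circ_simps [simp]:
  "(x + y) \<circ>\<^sub>e z = x \<circ>\<^sub>e z + y \<circ>\<^sub>e z" "(x - y) \<circ>\<^sub>e z = x \<circ>\<^sub>e z - y \<circ>\<^sub>e z"
  "(- x) \<circ>\<^sub>e z = - (x \<circ>\<^sub>e z)" "scale k x \<circ>\<^sub>e z = scale k (x \<circ>\<^sub>e z)"
  "z \<circ>\<^sub>e (x + y) = z \<circ>\<^sub>e x + z \<circ>\<^sub>e y" "z \<circ>\<^sub>e (x - y) = z \<circ>\<^sub>e x - z \<circ>\<^sub>e y"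
  "z \<circ>\<^sub>e (- x) = - (z \<circ>\<^sub>e x)" "z \<circ>\<^sub>e scale k x = scale k (z \<circ>\<^sub>e x)"
  by (simp_all add: circ_def)

lemma circ_e [simp]: "x \<circ>\<^sub>e e = R x" "e \<circ>\<^sub>e x = x"
  by (simp_all add: circ_def R_op_def left_unit)

text \<open>Division by 2, and below by 3, in additive form: many equations are first proved with
  such a factor on both sides.\<close>

lemma double_cancel: "x + x = y + y \<Longrightarrow> x = (y :: 'v)"
  using two_nz scale_left_imp_eq[of 2 x y] by (simp add: scale_numerals)

lemma triple_cancel: "x + x + x = y + y + y \<Longrightarrow> x = (y :: 'v)"
  using three_nz scale_left_imp_eq[of 3 x y] by (simp add: scale_numerals)

section \<open>Identities for \<open>R\<close>, \<open>Q\<close> and the product\<close>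

text \<open>The left unit law turns both \<open>T a b (T e e f)\<close> and
  \<open>T e e (T a b f)\<close> into \<open>T a b f\<close>, which cancels.\<close>

lemma left_mult_swap: "T (T a b e) e f = T e (T b a e) f"
  using jordan_identity[of a b e e f] by (simp add: left_unit)

lemma left_mult_R: "T e (R b) f = Q b \<circ>\<^sub>e f"
  using left_mult_swap[of e b f] by (simp add: R_op_def Q_op_def circ_def)

lemma left_mult_Q: "T e (Q b) f = R b \<circ>\<^sub>e f"
  using left_mult_swap[of b e f] by (simp add: R_op_def Q_op_def circ_def)

lemma RQ_commute: "R (Q x) = Q (R x)"
  using left_mult_R[of x e] by (simp add: Q_op_def circ_def R_op_def)

lemma QQ_eq_RR: "Q (Q x) = R (R x)"
  using left_mult_Q[of x e] by (simp add: Q_op_def circ_def R_op_def)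

text \<open>With \<open>e\<close> in the other three places, each of the three subtracted terms of
  the second identity becomes \<open>a \<circ>\<^sub>e b\<close>.\<close>

lemma R_commutator: "R (a \<circ>\<^sub>e b - b \<circ>\<^sub>e a) = scale 3 (a \<circ>\<^sub>e b - b \<circ>\<^sub>e a)"
  using second_order_identity[of a e b e e]
  by (simp add: R_op_def circ_def left_unit scale_numerals algebra_simps)

text \<open>\<open>R x - x\<close> is the commutator of \<open>x\<close> with \<open>e\<close>,
  hence an eigenvector of \<open>R\<close> for 3.\<close>

lemma RR: "R (R x) = R x + R x + R x + R x - x - x - x"
  using R_commutator[of x e] by (simp add: scale_numerals algebra_simps)

lemma T_Q_snd: "T x (Q w) z = (w \<circ>\<^sub>e x) \<circ>\<^sub>e z + x \<circ>\<^sub>e (w \<circ>\<^sub>e z) - w \<circ>\<^sub>e (x \<circ>\<^sub>e z)"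
  using jordan_identity[of w e x e z] by (simp add: Q_op_def circ_def algebra_simps)

lemma R_circ:
  "R (y \<circ>\<^sub>e x) = R x \<circ>\<^sub>e y - x \<circ>\<^sub>e y - y \<circ>\<^sub>e R x + y \<circ>\<^sub>e x + y \<circ>\<^sub>e x - x \<circ>\<^sub>e R y + R y \<circ>\<^sub>e x"
proof -
  \<comment> \<open>Two triple products with middle entry \<open>Q y\<close> remain. Rewritten in
    terms of the product, the first one contributes \<open>R (y \<circ>\<^sub>e x)\<close>, for
    which the equation is then solved.\<close>
  have "(R x - x) \<circ>\<^sub>e y - y \<circ>\<^sub>e (R x - x) = y \<circ>\<^sub>e (R x - x) + T x (Q y) e - T e (Q y) x"
    using second_order_identity[of x e e e y]
    by (simp add: R_op_def Q_op_def circ_def left_unit algebra_simps)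
  then show ?thesis by (simp add: T_Q_snd left_mult_Q algebra_simps)
qed

text \<open>Entries in the image of \<open>Q\<close> are chosen so that \<open>T_Q_snd\<close>
  expands both sides of \<open>left_mult_swap\<close> into products.\<close>

lemma R_Q_circ:
  "R (R (x \<circ>\<^sub>e Q w) + Q w \<circ>\<^sub>e R x - x \<circ>\<^sub>e R (Q w)) = Q (R (w \<circ>\<^sub>e Q x) + Q x \<circ>\<^sub>e R w - w \<circ>\<^sub>e R (Q x))"
proof -
  have "R (T (Q w) (Q x) e) = Q (T (Q x) (Q w) e)"
    using left_mult_swap[of "Q w" "Q x" e] by (simp add: R_op_def Q_op_def)
  then show ?thesis by (simp only: T_Q_snd circ_e)
qed

text \<open>For equal eigenvalues, here 1 and next 3, \<open>R - 1\<close> sends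
  \<open>y \<circ>\<^sub>e x\<close> to a commutator; this is the antisymmetry of
  \<open>A3\<close>.\<close>

lemma R_circ_same_1:
  assumes "R x = x" "R y = y"
  shows "R (y \<circ>\<^sub>e x) = y \<circ>\<^sub>e x + y \<circ>\<^sub>e x - x \<circ>\<^sub>e y"
  using R_circ[of y x] assms by (simp add: algebra_simps)

lemma R_circ_same_3:
  assumes "R x = x + x + x" "R y = y + y + y"
  shows "R (y \<circ>\<^sub>e x) = y \<circ>\<^sub>e x + y \<circ>\<^sub>e x - x \<circ>\<^sub>e y"
  using R_circ[of y x] assms by (simp add: algebra_simps)

lemma R_circ_mixed:
  assumes "R x = x + x + x" "R y = y"
  shows "R (y \<circ>\<^sub>e x) = x \<circ>\<^sub>e y"
  using R_circ[of y x] assms by (simp add: algebra_simps)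

section \<open>Projections onto the eigenspaces of \<open>R\<close>\<close>

text \<open>\<open>P1\<close> and \<open>P3\<close> are the Lagrange projections belonging to the
  roots 1 and 3 of \<open>(R - 1)(R - 3) = 0\<close>.\<close>

definition P1 :: "'v \<Rightarrow> 'v" where "P1 x = scale (1 / 2) (scale 3 x - R x)"

definition P3 :: "'v \<Rightarrow> 'v" where "P3 x = scale (1 / 2) (R x - x)"

lemma half: "scale (1 / 2) x + scale (1 / 2) x = x"
  using two_nz scale_scale[of 2 "1/2" x] by (simp add: scale_numerals del: scale_scale)

lemma third: "scale (1 / 3) x + scale (1 / 3) x + scale (1 / 3) x = x"
  using three_nz scale_scale[of 3 "1/3" x] by (simp add: scale_numerals del: scale_scale)

lemma double_P: "P1 x + P1 x = x + x + x - R x" "P3 x + P3 x = R x - x"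
  by (simp_all only: P1_def P3_def half scale_numerals)

lemma P_sum: "P1 x + P3 x = x"
proof (rule double_cancel)
  have "P1 x + P3 x + (P1 x + P3 x) = (P1 x + P1 x) + (P3 x + P3 x)" by (simp only: ac_simps)
  then show "P1 x + P3 x + (P1 x + P3 x) = x + x" by (simp add: double_P)
qed

lemma R_P1: "R (P1 x) = P1 x"
  by (simp add: P1_def RR scale_numerals algebra_simps)

lemma R_P3: "R (P3 x) = scale 3 (P3 x)"
proof -
  have "R (R x - x) = scale 3 (R x - x)" by (simp add: RR scale_numerals algebra_simps)
  then show ?thesis unfolding P3_def by (simp only: RQ_simps scale_left_commute)
qed

section \<open>The tilde involution\<close>

text \<open>Since \<open>R\<close> is \<open>1\<close> on \<open>U11\<close> and \<open>3\<close> on \<open>U13\<close>, this map is \<open>Q\<close> on \<open>U11\<close>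
  and \<open>- Q / 3\<close> on \<open>U13\<close>.\<close>
definition tilde :: "'v \<Rightarrow> 'v" where "tilde x = scale (1 / 3) (scale 5 (Q x) - scale 2 (Q (R x)))"

lemma triple_tilde:
  "tilde x + tilde x + tilde x = Q x + Q x + Q x + Q x + Q x - Q (R x) - Q (R x)"
  by (simp only: tilde_def third scale_numerals) (simp add: algebra_simps)

lemma linear_tilde: "Vector_Spaces.linear scale scale tilde"
  by unfold_locales (simp_all add: tilde_def scale_right_distrib scale_right_diff_distrib algebra_simps)


lemma tilde_simps [simp]:
  "tilde (x + y) = tilde x + tilde y" "tilde (x - y) = tilde x - tilde y"
  "tilde (- x) = - tilde x" "tilde (scale k x) = scale k (tilde x)" "tilde 0 = 0"
  by (simp_all add: tilde_def scale_right_distrib scale_right_diff_distrib algebra_simps)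

lemma R_tilde: "R (tilde x) = tilde (R x)"
  by (simp add: tilde_def RQ_commute)

lemma tilde_U11: "R x = x \<Longrightarrow> tilde x = Q x"
  by (rule triple_cancel, unfold triple_tilde) (simp add: algebra_simps)

lemma triple_tilde_U13: "R x = x + x + x \<Longrightarrow> tilde x + tilde x + tilde x = - Q x"
  unfolding triple_tilde by (simp add: algebra_simps)

lemma Q_tilde_U11: "R x = x \<Longrightarrow> Q (tilde x) = x"
  by (simp add: tilde_U11 QQ_eq_RR)

lemma Q_tilde_U13:
  assumes "R x = x + x + x"
  shows "Q (tilde x) = - (x + x + x)"
proof (rule triple_cancel)
  have "Q (tilde x + tilde x + tilde x) = - Q (Q x)"
    using triple_tilde_U13[OF assms] by simp
  then show "Q (tilde x) + Q (tilde x) + Q (tilde x) = - (x + x + x) + - (x + x + x) + - (x + x + x)"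
    by (simp add: QQ_eq_RR assms algebra_simps)
qed

text \<open>On \<open>U11\<close> the square is \<open>Q^2 = R^2 = 1\<close>; on \<open>U13\<close>
  it is \<open>Q^2 / 9 = R^2 / 9 = 1\<close>.\<close>

lemma tilde_tilde: "tilde (tilde x) = x"
proof -
  have "tilde (tilde (P1 x)) = P1 x"
    using tilde_U11[of "tilde (P1 x)"] by (simp add: R_P1 R_tilde Q_tilde_U11)
  moreover have "tilde (tilde (P3 x)) = P3 x"
  proof (rule triple_cancel)
    have *: "R (P3 x) = P3 x + P3 x + P3 x" by (simp add: R_P3 scale_numerals)
    then have "R (tilde (P3 x)) = tilde (P3 x) + tilde (P3 x) + tilde (P3 x)"
      by (simp add: R_tilde)
    from triple_tilde_U13[OF this] Q_tilde_U13[OF *]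
    show "tilde (tilde (P3 x)) + tilde (tilde (P3 x)) + tilde (tilde (P3 x)) = P3 x + P3 x + P3 x"
      by simp
  qed
  ultimately have "tilde (tilde (P1 x + P3 x)) = P1 x + P3 x" by simp
  then show ?thesis by (simp add: P_sum)
qed

section \<open>Multiplicativity of the tilde map\<close>

lemma tilde_circ_11:
  assumes x: "R x = x" and w: "R w = w"
  shows "tilde (x \<circ>\<^sub>e w) = tilde x \<circ>\<^sub>e tilde w"
proof (rule triple_cancel)
  have tx: "R (tilde x) = tilde x" and tw: "R (tilde w) = tilde w"
    by (simp_all add: R_tilde x w)
  note R_rules = R_circ_same_1[OF x w] R_circ_same_1[OF w x] R_circ_same_1[OF tx tw] R_circ_same_1[OF tw tx]
  note Q_rules = Q_tilde_U11[OF x] Q_tilde_U11[OF w] tilde_U11[OF x, symmetric] tilde_U11[OF w, symmetric]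
  \<comment> \<open>Since \<open>Q (tilde x) = x\<close> and \<open>Q w = tilde w\<close>, inserting
    \<open>tilde x\<close> expresses \<open>Q\<close> of a product of \<open>x\<close> and
    \<open>w\<close> by products of \<open>tilde x\<close> and \<open>tilde w\<close>. Exchanging
    the roles gives the other order.\<close>
  have 1: "Q (w \<circ>\<^sub>e x) = tilde x \<circ>\<^sub>e tilde w + tilde x \<circ>\<^sub>e tilde w - tilde w \<circ>\<^sub>e tilde x"
    using R_Q_circ[of "tilde x" w] by (simp add: Q_rules R_rules x w tx tw algebra_simps)
  have 2: "Q (x \<circ>\<^sub>e w) = tilde w \<circ>\<^sub>e tilde x + tilde w \<circ>\<^sub>e tilde x - tilde x \<circ>\<^sub>e tilde w"
    using R_Q_circ[of "tilde w" x] by (simp add: Q_rules R_rules x w tx tw algebra_simps)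
  show "tilde (x \<circ>\<^sub>e w) + tilde (x \<circ>\<^sub>e w) + tilde (x \<circ>\<^sub>e w) =
      tilde x \<circ>\<^sub>e tilde w + tilde x \<circ>\<^sub>e tilde w + tilde x \<circ>\<^sub>e tilde w"
    unfolding triple_tilde by (simp add: R_rules 1 2 algebra_simps)
qed

lemma Q_U13: "R x = x + x + x \<Longrightarrow> Q x = - (tilde x + tilde x + tilde x)"
  by (simp only: triple_tilde_U13 minus_minus)

lemma tilde_circ_33:
  assumes x: "R x = x + x + x" and w: "R w = w + w + w"
  shows "tilde (x \<circ>\<^sub>e w) = tilde x \<circ>\<^sub>e tilde w"
proof -
  have tx: "R (tilde x) = tilde x + tilde x + tilde x" and tw: "R (tilde w) = tilde w + tilde w + tilde w"
    by (simp_all add: R_tilde x w)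
  note R_rules = R_circ_same_3[OF x w] R_circ_same_3[OF w x] R_circ_same_3[OF tx tw] R_circ_same_3[OF tw tx]
  note Q_rules = Q_tilde_U13[OF x] Q_tilde_U13[OF w] Q_U13[OF x] Q_U13[OF w]
  define B B' D D' where "B = tilde x \<circ>\<^sub>e tilde w" and "B' = tilde w \<circ>\<^sub>e tilde x"
    and "D = Q (x \<circ>\<^sub>e w)" and "D' = Q (w \<circ>\<^sub>e x)"
  note defs = B_def[symmetric] B'_def[symmetric] D_def[symmetric] D'_def[symmetric]
  have RB: "R B = B + B - B'" "R B' = B' + B' - B"
    unfolding B_def B'_def by (simp_all only: R_rules)
  \<comment> \<open>The same substitution as on \<open>U11\<close>; now \<open>Q\<close> and
    \<open>tilde\<close> differ by the factor -3, and a common factor 3 is cancelled. This gives a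
    linear system for \<open>D\<close> and \<open>D'\<close>.\<close>
  have 1: "D + D - D' = B' + B' + B' + B' + B' - B - B - B - B"
    using R_Q_circ[of "tilde x" w]
    by - (rule triple_cancel, simp add: Q_rules R_rules x w tx tw defs RB algebra_simps)
  have 2: "D' + D' - D = B + B + B + B + B - B' - B' - B' - B'"
    using R_Q_circ[of "tilde w" x]
    by - (rule triple_cancel, simp add: Q_rules R_rules x w tx tw defs RB algebra_simps)
  have D': "D' = D + D - (B' + B' + B' + B' + B' - B - B - B - B)"
    by (simp flip: 1)
  \<comment> \<open>Twice \<open>1\<close> plus \<open>2\<close> eliminates \<open>D'\<close> and
    leaves three times the claim.\<close>
  have D: "D = B' + B' - B"
  proof (rule triple_cancel)
    have "D + D + D = (D' + D' - D) + (B' + B' + B' + B' + B' - B - B - B - B) + (B' + B' + B' + B' + B' - B - B - B - B)"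
      unfolding D' by (simp add: algebra_simps)
    then show "D + D + D = (B' + B' - B) + (B' + B' - B) + (B' + B' - B)"
      unfolding 2 by (simp add: algebra_simps)
  qed
  have "D + D' + D' = B + B + B"
    unfolding D' D by (simp add: algebra_simps)
  moreover have "tilde (x \<circ>\<^sub>e w) + tilde (x \<circ>\<^sub>e w) + tilde (x \<circ>\<^sub>e w) = D + D' + D'"
    unfolding triple_tilde by (simp add: R_rules defs algebra_simps)
  ultimately show ?thesis unfolding B_def by - (rule triple_cancel, simp)
qed

lemma tilde_circ_mixed:
  assumes x: "R x = x + x + x" and w: "R w = w"
  shows "tilde (x \<circ>\<^sub>e w) = tilde x \<circ>\<^sub>e tilde w" "tilde (w \<circ>\<^sub>e x) = tilde w \<circ>\<^sub>e tilde x"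
proof -
  have tx: "R (tilde x) = tilde x + tilde x + tilde x" and tw: "R (tilde w) = tilde w"
    by (simp_all add: R_tilde x w)
  define B' D' where "B' = tilde w \<circ>\<^sub>e tilde x" and "D' = w \<circ>\<^sub>e x"
  \<comment> \<open>\<open>R\<close> turns one order of a mixed product into the other, so
    everything is expressed by \<open>B'\<close>, \<open>D'\<close> and their images under
    \<open>R\<close>; higher powers are reduced by \<open>RR\<close>.\<close>
  have B: "tilde x \<circ>\<^sub>e tilde w = R B'" and D: "x \<circ>\<^sub>e w = R D'"
    unfolding B'_def D'_def using R_circ_mixed x w tx tw by simp_all
  note defs = B'_def[symmetric] D'_def[symmetric] B D
  note Q_rules = Q_tilde_U13[OF x] Q_tilde_U11[OF w] Q_U13[OF x] tilde_U11[OF w, symmetric]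
  have 1: "Q D' + Q D' + Q D' - Q (R D') - Q (R D') = R B' + R B' + R B' + R B' - B' - B' - B'"
    using R_Q_circ[of "tilde x" w]
    by - (rule triple_cancel, simp add: Q_rules x w tx tw defs RR algebra_simps)
  have 2: "Q (R D') = B' + B' + B' + B' + B' + B' - R B' - R B' - R B' - R B' - R B'"
    using R_Q_circ[of "tilde w" x]
    by - (rule triple_cancel, simp add: Q_rules x w tx tw defs RR algebra_simps)
  have 3: "Q D' = B' + B' + B' - R B' - R B'"
  proof (rule triple_cancel)
    have "Q D' + Q D' + Q D' = (Q D' + Q D' + Q D' - Q (R D') - Q (R D')) + Q (R D') + Q (R D')"
      by simp
    also have "\<dots> = (R B' + R B' + R B' + R B' - B' - B' - B') + Q (R D') + Q (R D')"
      unfolding 1 ..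
    finally show "Q D' + Q D' + Q D' = B' + B' + B' - R B' - R B' + (B' + B' + B' - R B' - R B')
        + (B' + B' + B' - R B' - R B')"
      by (simp add: 2 algebra_simps)
  qed
  show "tilde (x \<circ>\<^sub>e w) = tilde x \<circ>\<^sub>e tilde w"
    unfolding B D by (rule triple_cancel, unfold triple_tilde) (simp add: 2 3 RR algebra_simps)
  show "tilde (w \<circ>\<^sub>e x) = tilde w \<circ>\<^sub>e tilde x"
    unfolding defs by (rule triple_cancel, unfold triple_tilde) (simp add: 2 3 RR algebra_simps)
qed

lemma tilde_circ: "tilde (x \<circ>\<^sub>e y) = tilde x \<circ>\<^sub>e tilde y"
proof -
  have 1: "R (P1 z) = P1 z" and 3: "R (P3 z) = P3 z + P3 z + P3 z" for z
    by (simp_all add: R_P1 R_P3 scale_numerals)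
  have "tilde ((P1 x + P3 x) \<circ>\<^sub>e (P1 y + P3 y)) = tilde (P1 x + P3 x) \<circ>\<^sub>e tilde (P1 y + P3 y)"
    by (simp add: tilde_circ_11[OF 1 1] tilde_circ_33[OF 3 3] tilde_circ_mixed[OF 3 1])
  then show ?thesis by (simp only: P_sum)
qed

lemma automorphism_tilde: "involutive_automorphism scale (circ T e) tilde"
  unfolding involutive_automorphism_def
  using linear_tilde tilde_circ tilde_tilde o_bij[of tilde tilde] by (auto simp: fun_eq_iff)

section \<open>Joint eigenspaces of \<open>R\<close> and \<open>tilde\<close>, and direct
  sums\<close>

text \<open>The projections onto the eigenspaces of the involution \<open>tilde\<close> for 1 and
  -1. They commute with \<open>R\<close>, so together with \<open>P1\<close> and \<open>P3\<close>
  they split the space into four parts.\<close>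

definition M_plus :: "'v \<Rightarrow> 'v" where "M_plus x = scale (1 / 2) (x + tilde x)"

definition M_minus :: "'v \<Rightarrow> 'v" where "M_minus x = scale (1 / 2) (x - tilde x)"

lemma double_M: "M_plus x + M_plus x = x + tilde x" "M_minus x + M_minus x = x - tilde x"
  by (simp_all only: M_plus_def M_minus_def half)

lemma M_sum: "M_plus x + M_minus x = x"
proof (rule double_cancel)
  have "M_plus x + M_minus x + (M_plus x + M_minus x) = (M_plus x + M_plus x) + (M_minus x + M_minus x)"
    by (simp only: ac_simps)
  then show "M_plus x + M_minus x + (M_plus x + M_minus x) = x + x" by (simp add: double_M)
qed

lemma tilde_M: "tilde (M_plus x) = M_plus x" "tilde (M_minus x) = - M_minus x"
  by (simp_all add: M_plus_def M_minus_def tilde_tilde add.commute flip: scale_minus_right)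

lemma R_M: "R (M_plus x) = M_plus (R x)" "R (M_minus x) = M_minus (R x)"
  by (simp_all add: M_plus_def M_minus_def R_tilde)

lemma M_simps [simp]:
  "M_plus (x + y) = M_plus x + M_plus y" "M_minus (x + y) = M_minus x + M_minus y"
  "M_plus (scale k x) = scale k (M_plus x)" "M_minus (scale k x) = scale k (M_minus x)"
  by (simp_all add: M_plus_def M_minus_def algebra_simps)

lemma P_simps [simp]: "P1 (x + y) = P1 x + P1 y" "P3 (x + y) = P3 x + P3 y"
  by (simp_all add: P1_def P3_def algebra_simps)

lemma M_eigen:
  "tilde x = x \<Longrightarrow> M_plus x = x" "tilde x = x \<Longrightarrow> M_minus x = 0"
  "tilde x = - x \<Longrightarrow> M_plus x = 0" "tilde x = - x \<Longrightarrow> M_minus x = x"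
  by (simp_all add: M_plus_def M_minus_def scale_right_distrib half)

lemma P_eigen:
  "R x = x \<Longrightarrow> P1 x = x" "R x = x \<Longrightarrow> P3 x = 0"
  "R x = scale 3 x \<Longrightarrow> P1 x = 0" "R x = scale 3 x \<Longrightarrow> P3 x = x"
  by (simp_all add: P1_def P3_def scale_numerals half flip: scale_right_distrib)
     (simp_all add: scale_right_distrib half)

text \<open>On an eigenspace of \<open>R\<close>, \<open>tilde\<close> is a nonzero multiple of
  \<open>Q\<close>, so the four spaces are joint eigenspaces of \<open>R\<close> and
  \<open>tilde\<close>. On \<open>U13\<close> the signs of \<open>Q\<close> and \<open>tilde\<close>
  are opposite.\<close>

lemma U11p_eq: "U11p T e = {x. R x = x \<and> tilde x = x}"
  by (auto simp: U11p_def tilde_U11)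

lemma U11m_eq: "U11m T e = {x. R x = x \<and> tilde x = - x}"
  by (auto simp: U11m_def tilde_U11)

lemma U13p_eq: "U13p scale T e = {x. R x = scale 3 x \<and> tilde x = - x}"
proof -
  have "Q x = x + x + x \<longleftrightarrow> tilde x = - x" if "R x = x + x + x" for x
  proof
    assume "Q x = x + x + x"
    then show "tilde x = - x" using triple_tilde_U13[OF that] by - (rule triple_cancel, simp)
  qed (use Q_U13[OF that] in simp)
  then show ?thesis by (auto simp: U13p_def scale_numerals)
qed

lemma U13m_eq: "U13m scale T e = {x. R x = scale 3 x \<and> tilde x = x}"
proof -
  have "Q x = - (x + x + x) \<longleftrightarrow> tilde x = x" if "R x = x + x + x" for x
  proof
    assume "Q x = - (x + x + x)"
    then show "tilde x = x" using triple_tilde_U13[OF that] by - (rule triple_cancel, simp)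
  qed (use Q_U13[OF that] in simp)
  then show ?thesis by (auto simp: U13m_def scale_numerals)
qed

lemmas U_eqs = U11p_eq U11m_eq U13p_eq U13m_eq

lemma set_sumI: "a \<in> A \<Longrightarrow> b \<in> B \<Longrightarrow> a + b = x \<Longrightarrow> x \<in> set_sum A B"
  by (auto simp: set_sum_def)

lemma U11_eq: "U11 T e = {x. R x = x}"
proof -
  have "x \<in> U11 T e" if "R x = x" for x
    unfolding U11_def by (rule set_sumI[OF _ _ M_sum]) (simp_all add: U_eqs R_M tilde_M that)
  then show ?thesis by (auto simp: U11_def set_sum_def U_eqs)
qed

lemma U13_eq: "U13 scale T e = {x. R x = scale 3 x}"
proof -
  \<comment> \<open>The summands of \<open>M_sum\<close> are exchanged because \<open>U13p\<close>,
    listed first, has \<open>tilde\<close> equal to -1.\<close>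
  have "x \<in> U13 scale T e" if "R x = scale 3 x" for x
    unfolding U13_def
    by (rule set_sumI[OF _ _ M_sum[of x, unfolded add.commute[of "M_plus x"]]]) (simp_all add: U_eqs R_M tilde_M that)
  then show ?thesis by (auto simp: U13_def set_sum_def U_eqs scale_right_distrib)
qed

lemma tilde_P: "tilde (P1 x) = P1 (tilde x)" "tilde (P3 x) = P3 (tilde x)"
  by (simp_all add: P1_def P3_def R_tilde)

lemma P_neg [simp]: "P1 (- x) = - P1 x" "P3 (- x) = - P3 x"
  by (simp_all add: P1_def P3_def flip: scale_minus_right)

text \<open>\<open>P1\<close> and \<open>P3\<close> commute with \<open>tilde\<close>, so they split
  a fixed vector inside the fixed space. With this description the inclusions between products
  follow from \<open>tilde_circ\<close>.\<close>

lemma U_plus_eq: "U_plus scale T e = {x. tilde x = x}"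
proof -
  have "x \<in> U_plus scale T e" if "tilde x = x" for x
    unfolding U_plus_def
    by (rule set_sumI[OF _ _ P_sum]) (simp_all add: U_eqs tilde_P R_P1 R_P3 that)
  then show ?thesis by (auto simp: U_plus_def set_sum_def U_eqs)
qed

lemma U_minus_eq: "U_minus scale T e = {x. tilde x = - x}"
proof -
  have "x \<in> U_minus scale T e" if "tilde x = - x" for x
    unfolding U_minus_def
    by (rule set_sumI[OF _ _ P_sum]) (simp_all add: U_eqs tilde_P R_P1 R_P3 that)
  then show ?thesis by (auto simp: U_minus_def set_sum_def U_eqs)
qed

lemma subspaces:
  "subspace (U11p T e)" "subspace (U11m T e)" "subspace (U13p scale T e)" "subspace (U13m scale T e)"
  by (auto simp: subspace_def U_eqs scale_right_distrib mult.commute)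

text \<open>All four equations amount to \<open>x + x = 0\<close>; thus distinct eigenspaces meet
  only in 0.\<close>

lemma zero_iffs: "x = - x \<longleftrightarrow> x = (0::'v)" "- x = x \<longleftrightarrow> x = 0" "x = scale 3 x \<longleftrightarrow> x = 0" "scale 3 x = x \<longleftrightarrow> x = 0"
  using double_cancel[of x 0]
  by (auto simp: scale_numerals eq_neg_iff_add_eq_0 neg_eq_iff_add_eq_0 add.assoc)

lemma direct_sums:
  "is_direct_sum scale (U11 T e) [U11p T e, U11m T e]"
  "is_direct_sum scale (U13 scale T e) [U13p scale T e, U13m scale T e]"
  "is_direct_sum scale (U_plus scale T e) [U11p T e, U13m scale T e]"
  "is_direct_sum scale (U_minus scale T e) [U11m T e, U13p scale T e]"
  unfolding U11_def U13_def U_plus_def U_minus_def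
  using subspaces by - (rule is_direct_sum_set_sum, assumption, assumption, force simp: U_eqs zero_iffs)+

lemma direct_sum_UNIV:
  "is_direct_sum scale UNIV [U11p T e, U11m T e, U13p scale T e, U13m scale T e]"
proof -
  \<comment> \<open>The inverse of the summation map: each component is a product of two commuting
    projections.\<close>
  let ?f = "\<lambda>x. [M_plus (P1 x), M_minus (P1 x), M_minus (P3 x), M_plus (P3 x)]"
  have sum: "sum_list (?f x) = x" for x
    using M_sum[of "P1 x"] M_sum[of "P3 x"] P_sum[of x] by (simp add: add.commute add.left_commute)
  have "bij_betw sum_list (listset [U11p T e, U11m T e, U13p scale T e, U13m scale T e]) UNIV"
  proof (rule bij_betw_byWitness[where f' = ?f])
    show "\<forall>vs\<in>listset [U11p T e, U11m T e, U13p scale T e, U13m scale T e]. ?f (sum_list vs) = vs"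
      by (auto simp: set_Cons_def U_eqs P_eigen M_eigen)
    show "?f ` UNIV \<subseteq> listset [U11p T e, U11m T e, U13p scale T e, U13m scale T e]"
      by (auto simp: set_Cons_def U_eqs tilde_M R_M R_P1 R_P3)
  qed (use sum in blast)+
  then show ?thesis by (simp add: is_direct_sum_def subspaces)
qed

section \<open>Invertibility of \<open>Q\<close> and the triple product\<close>

lemma inj_Q: "inj Q"
proof (rule injI)
  fix x y assume "Q x = Q y"
  define d where "d = x - y"
  have 0: "R (R d) = 0" using \<open>Q x = Q y\<close> by (simp add: d_def flip: QQ_eq_RR)
  \<comment> \<open>With \<open>R (R d) = 0\<close> the quadratic relation reads
    \<open>4 R d = 3 d\<close>; applying \<open>R\<close> once more gives
    \<open>3 R d = 0\<close>.\<close>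
  then have 3: "R d + R d + R d + R d = d + d + d"
    unfolding RR by (simp only: diff_diff_eq) simp
  have "R d + R d + R d = R (d + d + d)" by simp
  also have "\<dots> = 0" unfolding 3[symmetric] by (simp only: RQ_simps 0) simp
  finally have "R d = 0" by - (rule triple_cancel, simp)
  then have "d = 0" using 3 by - (rule triple_cancel, simp)
  then show "x = y" by (simp add: d_def)
qed

text \<open>The quadratic relation reads \<open>R (4 - R) = 3\<close>, which exhibits the
  preimage.\<close>

lemma surj_R: "\<exists>z. y = R z"
proof
  have "y = scale (1 / 3) (y + y + y)" by (simp add: scale_right_distrib third)
  also have "y + y + y = R (y + y + y + y - R y)" by (simp add: RR algebra_simps)
  finally show "y = R (scale (1 / 3) (y + y + y + y - R y))" by simp
qed

lemma bij_Q: "bij Q"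
proof (rule bijI[OF inj_Q], rule surjI)
  fix y
  obtain z where "y = R (R z)" using surj_R by metis
  then have "y = Q (Q z)" by (simp add: QQ_eq_RR)
  then show "Q (inv Q y) = y" by (simp add: f_inv_into_f)
qed

lemma triple_product:
  "T x y z = (inv Q y \<circ>\<^sub>e x) \<circ>\<^sub>e z + x \<circ>\<^sub>e (inv Q y \<circ>\<^sub>e z) - inv Q y \<circ>\<^sub>e (x \<circ>\<^sub>e z)"
  using T_Q_snd[of x "inv Q y" z] bij_Q by (simp add: bij_is_surj surj_f_inv_f)

section \<open>Symmetry of the two components of the product, and uniqueness of the tilde
  map\<close>

lemma P1_circ_commute: "P1 (x \<circ>\<^sub>e y) = P1 (y \<circ>\<^sub>e x)"
proof -
  have "P1 (x \<circ>\<^sub>e y - y \<circ>\<^sub>e x) = 0" by (rule P_eigen(3)[OF R_commutator])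
  then show ?thesis using P_simps(1)[of "x \<circ>\<^sub>e y - y \<circ>\<^sub>e x" "y \<circ>\<^sub>e x"] by simp
qed

lemma P3_eqI: "R x - x = R y - y \<Longrightarrow> P3 x = P3 y"
  by (simp only: P3_def)

lemma P3_circ_same:
  assumes "R (x \<circ>\<^sub>e y) = x \<circ>\<^sub>e y + x \<circ>\<^sub>e y - y \<circ>\<^sub>e x" "R (y \<circ>\<^sub>e x) = y \<circ>\<^sub>e x + y \<circ>\<^sub>e x - x \<circ>\<^sub>e y"
  shows "P3 (x \<circ>\<^sub>e y) = - P3 (y \<circ>\<^sub>e x)"
proof -
  have "P3 (x \<circ>\<^sub>e y) = P3 (- (y \<circ>\<^sub>e x))" by (rule P3_eqI) (simp add: assms)
  then show ?thesis by simp
qed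

text \<open>The factor 3 is the eigenvalue of \<open>R\<close> on the image of \<open>P3\<close>,
  because \<open>x \<circ>\<^sub>e y = R (y \<circ>\<^sub>e x)\<close>.\<close>

lemma P3_circ_mixed:
  assumes "R x = scale 3 x" "R y = y"
  shows "P3 (x \<circ>\<^sub>e y) = scale 3 (P3 (y \<circ>\<^sub>e x))"
proof -
  have "R (y \<circ>\<^sub>e x) = x \<circ>\<^sub>e y" using assms by (intro R_circ_mixed) (simp_all add: scale_numerals)
  then have "P3 (x \<circ>\<^sub>e y) = P3 (R (y \<circ>\<^sub>e x))" by simp
  also have "\<dots> = R (P3 (y \<circ>\<^sub>e x))" by (simp add: P3_def)
  finally show ?thesis by (simp add: R_P3)
qed

lemma tilde_unique:
  assumes "is_tilde scale T e \<tau>"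
  shows "\<tau> = tilde"
proof
  fix x
  interpret Vector_Spaces.linear scale scale \<tau> using assms by (simp add: is_tilde_def)
  have "\<tau> (M_plus x + M_minus x) = tilde (M_plus x + M_minus x)"
    using assms by (simp add: add is_tilde_def U_plus_eq U_minus_eq tilde_M)
  then show "\<tau> x = tilde x" by (simp only: M_sum)
qed

lemma is_tilde_tilde: "is_tilde scale T e tilde"
  by (simp add: is_tilde_def linear_tilde U_plus_eq U_minus_eq)

section \<open>Weakly commutative systems\<close>

lemma weakly_commutative_U13p:
  assumes "weakly_commutative T"
  shows "U13p scale T e = {0}"
proof -
  \<comment> \<open>\<open>C2\<close> is the quadratic part of the cube of \<open>e + y\<close>;
    \<open>c1\<close> and \<open>c3\<close> are the parts of degree 1 and 3 of the difference of
    both sides of weak commutativity at \<open>e + y\<close>, with \<open>x = e\<close>.\<close>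
  define C2 where "C2 y = T y y e + T y e y + T e y y" for y
  define c1 where "c1 y = (y + R y + Q y) + R y - R (y + R y + Q y) - y" for y
  define c3 where "c3 y = e \<circ>\<^sub>e T y y y + y \<circ>\<^sub>e C2 y - T y y y \<circ>\<^sub>e e - C2 y \<circ>\<^sub>e y" for y
  have wc: "T y x (T y y y) = T (T y y y) x y" for x y
    using assms by (simp add: weakly_commutative_def)
  \<comment> \<open>The identity at \<open>e + y\<close> minus the one at \<open>e - y\<close> is twice its odd part in \<open>y\<close>.\<close>
  have odd: "c1 y + c3 y = 0" for y
  proof (rule double_cancel)
    have "c1 y + c3 y + (c1 y + c3 y) =
        (T (e + y) e (T (e + y) (e + y) (e + y)) - T (T (e + y) (e + y) (e + y)) e (e + y)) -
        (T (e - y) e (T (e - y) (e - y) (e - y)) - T (T (e - y) (e - y) (e - y)) e (e - y))"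
      by (simp add: c1_def c3_def C2_def R_op_def Q_op_def circ_def left_unit algebra_simps)
    then show "c1 y + c3 y + (c1 y + c3 y) = 0 + 0"
      unfolding wc by simp
  qed
  have c1_double: "c1 (y + y) = c1 y + c1 y" for y by (simp add: c1_def)
  have c3_double: "c3 (y + y) = c3 y + c3 y + (c3 y + c3 y) + (c3 y + c3 y + (c3 y + c3 y))" for y
    by (simp add: c3_def C2_def algebra_simps)
  \<comment> \<open>Doubling \<open>y\<close> scales the parts by 2 and 8, so comparison with the
    relation at \<open>y\<close> leaves \<open>6 c3 y = 0\<close>.\<close>
  have c1: "c1 y = 0" for y
  proof -
    have eq: "c1 y = - c3 y" using odd[of y] by (simp add: eq_neg_iff_add_eq_0)
    have "c3 y + c3 y + c3 y + (c3 y + c3 y + c3 y) = 0"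
      using odd[of "y + y"] by (simp add: c1_double c3_double eq algebra_simps)
    then have "c3 y = 0" by - (rule triple_cancel, rule double_cancel, simp)
    then show ?thesis using eq by simp
  qed
  have "y = 0" if "y \<in> U13p scale T e" for y
  proof -
    have "R y = y + y + y" "Q y = y + y + y" using that by (simp_all add: U13p_def scale_numerals)
    \<comment> \<open>Here \<open>c1 y = (7 + 3 - 21 - 1) y = - 12 y\<close>; the grouping prepares
      cancelling 3, 2 and 2.\<close>
    then have "- c1 y = (y + y + y) + (y + y + y) + ((y + y + y) + (y + y + y))"
      by (simp add: c1_def algebra_simps)
    then show ?thesis unfolding c1 by - (rule triple_cancel, rule double_cancel, rule double_cancel, simp)
  qed
  moreover have "0 \<in> U13p scale T e" by (simp add: U13p_def)
  ultimately show ?thesis by blast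
qed

lemma direct_sum_weakly_commutative:
  assumes "U13p scale T e = {0}"
  shows "is_direct_sum scale UNIV [U11p T e, U11m T e, U13m scale T e]"
proof -
  let ?f = "\<lambda>x. [M_plus (P1 x), M_minus (P1 x), M_plus (P3 x)]"
  \<comment> \<open>The omitted component lies in \<open>U13p\<close>, hence vanishes.\<close>
  have "M_minus (P3 x) \<in> U13p scale T e" for x by (simp add: U_eqs tilde_M R_M R_P3)
  then have sum: "sum_list (?f x) = x" for x
    using M_sum[of "P1 x"] M_sum[of "P3 x"] P_sum[of x] assms by (simp add: add.commute add.left_commute)
  have "bij_betw sum_list (listset [U11p T e, U11m T e, U13m scale T e]) UNIV"
  proof (rule bij_betw_byWitness[where f' = ?f])
    show "\<forall>vs\<in>listset [U11p T e, U11m T e, U13m scale T e]. ?f (sum_list vs) = vs"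
      by (auto simp: set_Cons_def U_eqs P_eigen M_eigen)
    show "?f ` UNIV \<subseteq> listset [U11p T e, U11m T e, U13m scale T e]"
      by (auto simp: set_Cons_def U_eqs tilde_M R_M R_P1 R_P3)
  qed (use sum in blast)+
  then show ?thesis by (simp add: is_direct_sum_def subspaces)
qed

section \<open>Decomposition of the product and final assembly\<close>

lemma circ_decomposition:
  "\<exists>A1 A3.
     (\<forall>x y. x \<circ>\<^sub>e y = A1 x y + A3 x y \<and> A1 x y \<in> U11 T e \<and> A3 x y \<in> U13 scale T e)
     \<and> (\<forall>x y. A1 x y = A1 y x)
     \<and> (\<forall>x\<in>U11 T e. \<forall>y\<in>U11 T e. A3 x y = - A3 y x)
     \<and> (\<forall>x\<in>U13 scale T e. \<forall>y\<in>U13 scale T e. A3 x y = - A3 y x)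
     \<and> (\<forall>x\<in>U13 scale T e. \<forall>y\<in>U11 T e. A3 x y = scale 3 (A3 y x))"
proof (intro exI conjI)
  \<comment> \<open>This first goal fixes the witnesses: the images of the product under
    \<open>P1\<close> and \<open>P3\<close>.\<close>
  show "\<forall>x y. x \<circ>\<^sub>e y = P1 (x \<circ>\<^sub>e y) + P3 (x \<circ>\<^sub>e y) \<and> P1 (x \<circ>\<^sub>e y) \<in> U11 T e \<and> P3 (x \<circ>\<^sub>e y) \<in> U13 scale T e"
    by (simp add: P_sum U11_eq U13_eq R_P1 R_P3)
  show "\<forall>x y. P1 (x \<circ>\<^sub>e y) = P1 (y \<circ>\<^sub>e x)"
    by (intro allI P1_circ_commute)
  show "\<forall>x\<in>U11 T e. \<forall>y\<in>U11 T e. P3 (x \<circ>\<^sub>e y) = - P3 (y \<circ>\<^sub>e x)"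
    by (intro ballI P3_circ_same R_circ_same_1) (simp_all add: U11_eq)
  show "\<forall>x\<in>U13 scale T e. \<forall>y\<in>U13 scale T e. P3 (x \<circ>\<^sub>e y) = - P3 (y \<circ>\<^sub>e x)"
    by (intro ballI P3_circ_same R_circ_same_3) (simp_all add: U13_eq scale_numerals)
  show "\<forall>x\<in>U13 scale T e. \<forall>y\<in>U11 T e. P3 (x \<circ>\<^sub>e y) = scale 3 (P3 (y \<circ>\<^sub>e x))"
    by (intro ballI P3_circ_mixed) (simp_all add: U11_eq U13_eq)
qed

lemma linear_circ:
  "Vector_Spaces.linear scale scale (\<lambda>x. x \<circ>\<^sub>e y)" "Vector_Spaces.linear scale scale (\<lambda>y. x \<circ>\<^sub>e y)"
  unfolding circ_def by (rule linear_fst linear_trd)+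

end

text \<open>Otherwise the characteristic would be a divisor of 2 different from 0, 1 and 2.\<close>

lemma two_neq_0_of_CHAR:
  assumes "CHAR('f::field) \<noteq> 2"
  shows "(2::'f) \<noteq> 0"
proof
  assume "(2::'f) = 0"
  then have dvd: "CHAR('f) dvd 2" using of_nat_eq_0_iff_char_dvd[of 2, where 'a='f] by simp
  then have "CHAR('f) \<le> 2" by (rule dvd_imp_le) simp
  moreover have "CHAR('f) \<noteq> 0" using dvd by (intro notI) simp
  moreover have "CHAR('f) \<noteq> 1" by simp
  ultimately show False using assms by linarith
qed

lemma three_neq_0_of_CHAR:
  assumes "CHAR('f::field) \<noteq> 3"
  shows "(3::'f) \<noteq> 0"
proof
  assume "(3::'f) = 0"
  then have dvd: "CHAR('f) dvd 3" using of_nat_eq_0_iff_char_dvd[of 3, where 'a='f] by simp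
  then have "CHAR('f) \<le> 3" by (rule dvd_imp_le) simp
  moreover have "CHAR('f) \<noteq> 0" "CHAR('f) \<noteq> 2" using dvd by - (intro notI, simp)+
  moreover have "CHAR('f) \<noteq> 1" by simp
  ultimately show False using assms by linarith
qed

theorem theorem3p3:
  fixes scale :: "'f::field \<Rightarrow> 'v::ab_group_add \<Rightarrow> 'v"
    and T :: "'v \<Rightarrow> 'v \<Rightarrow> 'v \<Rightarrow> 'v"
    and e :: 'v
  assumes gjts: "gjts_second_order scale T"
    and char: "CHAR('f) \<noteq> 2" "CHAR('f) \<noteq> 3" "CHAR('f) \<noteq> 5"
    and tripotent: "tripotent T e"
    and left_unit: "left_unit T e"
  shows
    "is_direct_sum scale UNIV [U11p T e, U11m T e, U13p scale T e, U13m scale T e]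
     \<and> is_direct_sum scale (U11 T e) [U11p T e, U11m T e]
     \<and> is_direct_sum scale (U13 scale T e) [U13p scale T e, U13m scale T e]
     \<and> is_direct_sum scale (U_plus scale T e) [U11p T e, U13m scale T e]
     \<and> is_direct_sum scale (U_minus scale T e) [U11m T e, U13p scale T e]
     \<and> (Vector_Spaces.linear scale scale (Q_op T e) \<and> bij (Q_op T e))
     \<and> (\<forall>x y z. T x y z =
           circ T e (circ T e (inv (Q_op T e) y) x) z
           + circ T e x (circ T e (inv (Q_op T e) y) z)
           - circ T e (inv (Q_op T e) y) (circ T e x z))
     \<and> (\<forall>y. Vector_Spaces.linear scale scale (\<lambda>x. circ T e x y))
     \<and> (\<forall>x. Vector_Spaces.linear scale scale (\<lambda>y. circ T e x y))
     \<and> (\<exists>A1 A3.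
           (\<forall>x y. circ T e x y = A1 x y + A3 x y
                  \<and> A1 x y \<in> U11 T e \<and> A3 x y \<in> U13 scale T e)
           \<and> (\<forall>x y. A1 x y = A1 y x)
           \<and> (\<forall>x\<in>U11 T e. \<forall>y\<in>U11 T e. A3 x y = - A3 y x)
           \<and> (\<forall>x\<in>U13 scale T e. \<forall>y\<in>U13 scale T e. A3 x y = - A3 y x)
           \<and> (\<forall>x\<in>U13 scale T e. \<forall>y\<in>U11 T e. A3 x y = scale 3 (A3 y x)))
     \<and> (\<exists>!\<tau>. is_tilde scale T e \<tau>)
     \<and> (\<forall>\<tau>. is_tilde scale T e \<tau> \<longrightarrow> involutive_automorphism scale (circ T e) \<tau>)
     \<and> (\<forall>x\<in>U_plus scale T e. \<forall>y\<in>U_plus scale T e. circ T e x y \<in> U_plus scale T e)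
     \<and> (\<forall>x\<in>U_minus scale T e. \<forall>y\<in>U_minus scale T e. circ T e x y \<in> U_plus scale T e)
     \<and> (\<forall>x\<in>U_minus scale T e. \<forall>y\<in>U_plus scale T e. circ T e x y \<in> U_minus scale T e)
     \<and> (\<forall>x\<in>U_plus scale T e. \<forall>y\<in>U_minus scale T e. circ T e x y \<in> U_minus scale T e)
     \<and> (weakly_commutative T \<longrightarrow>
           U13p scale T e = {0}
           \<and> is_direct_sum scale UNIV [U11p T e, U11m T e, U13m scale T e])"
proof -
  interpret gjts_left_unit scale T e
    using gjts left_unit two_neq_0_of_CHAR[OF char(1)] three_neq_0_of_CHAR[OF char(2)]
    by (simp add: gjts_left_unit_def gjts_left_unit_axioms_def left_unit_def)
  have "\<exists>!\<tau>. is_tilde scale T e \<tau>"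
    using is_tilde_tilde tilde_unique by blast
  moreover have "\<forall>\<tau>. is_tilde scale T e \<tau> \<longrightarrow> involutive_automorphism scale (circ T e) \<tau>"
    using tilde_unique automorphism_tilde by blast
  moreover have
    "\<forall>x\<in>U_plus scale T e. \<forall>y\<in>U_plus scale T e. x \<circ>\<^sub>e y \<in> U_plus scale T e"
    "\<forall>x\<in>U_minus scale T e. \<forall>y\<in>U_minus scale T e. x \<circ>\<^sub>e y \<in> U_plus scale T e"
    "\<forall>x\<in>U_minus scale T e. \<forall>y\<in>U_plus scale T e. x \<circ>\<^sub>e y \<in> U_minus scale T e"
    "\<forall>x\<in>U_plus scale T e. \<forall>y\<in>U_minus scale T e. x \<circ>\<^sub>e y \<in> U_minus scale T e"
    by (simp_all add: U_plus_eq U_minus_eq tilde_circ)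
  moreover have "weakly_commutative T \<longrightarrow> U13p scale T e = {0}
      \<and> is_direct_sum scale UNIV [U11p T e, U11m T e, U13m scale T e]"
    using weakly_commutative_U13p direct_sum_weakly_commutative by blast
  moreover have "\<forall>x y z. T x y z = (inv Q y \<circ>\<^sub>e x) \<circ>\<^sub>e z + x \<circ>\<^sub>e (inv Q y \<circ>\<^sub>e z) - inv Q y \<circ>\<^sub>e (x \<circ>\<^sub>e z)"
    using triple_product by blast
  moreover have "\<forall>y. Vector_Spaces.linear scale scale (\<lambda>x. x \<circ>\<^sub>e y)"
    "\<forall>x. Vector_Spaces.linear scale scale (\<lambda>y. x \<circ>\<^sub>e y)"
    using linear_circ by blast+
  ultimately show ?thesis
    by (intro conjI direct_sum_UNIV direct_sums linear_Q bij_Q circ_decomposition)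
qed

end
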